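(* Let $\mathcal{V}\subset\mathbb{R}^{n\times n}$ be a $d$-dimensional subspace, and let $F:\mathcal{V}\to\mathbb{R}$ be twice continuously differentiable with Lipschitz Hessian with parameter $L>0$ and bounded below by a finite $F^*$ on $\mathcal{V}$. Let $\boldsymbol{X}^*\in\mathcal{V}$ be a non-degenerate local minimum of $F$, i.e. $\nabla F(\boldsymbol{X}^* )=0$ and there exists $\delta>0$ such that $\langle\nabla^2F(\boldsymbol{X}^* )[\boldsymbol{H}],\boldsymbol{H}\rangle\ge\delta\|\boldsymbol{H}\|_F^2$ for all $\boldsymbol{H}\in\mathcal{V}$. If the cubic-regularized Newton algorithm (described in the context) is initialized at $\boldsymbol{X}_0$ sufficiently close to $\boldsymbol{X}^*$, then the generated sequence $\{\boldsymbol{X}_k\}$ converges quadratically to $\boldsymbol{X}^*$.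
   Context: $\langle\boldsymbol{A},\boldsymbol{B}\rangle=\operatorname{Tr}(\boldsymbol{A}^\top\boldsymbol{B})$ and $\|\cdot\|_F$ is the Frobenius norm. $\nabla F(\boldsymbol{X})\in\mathcal{V}$ is the gradient, i.e. $\langle\nabla F(\boldsymbol{X}),\boldsymbol{H}\rangle=\frac{d}{dt}F(\boldsymbol{X}+t\boldsymbol{H})|_{t=0}$ for all $\boldsymbol{H}\in\mathcal{V}$; the Hessian is $\nabla^2F(\boldsymbol{X})[\boldsymbol{H}]=\frac{d}{dt}\nabla F(\boldsymbol{X}+t\boldsymbol{H})|_{t=0}\in\mathcal{V}$; $D^2F(\boldsymbol{X})[\boldsymbol{H}_1,\boldsymbol{H}_2]=\langle\nabla^2F(\boldsymbol{X})[\boldsymbol{H}_1],\boldsymbol{H}_2\rangle$, with operator norm $\|D^2F(\boldsymbol{X})\|=\max\{|D^2F(\boldsymbol{X})[\boldsymbol{H}_1,\boldsymbol{H}_2]|:\|\boldsymbol{H}_1\|_F=\|\boldsymbol{H}_2\|_F=1,\ \boldsymbol{H}_i\in\mathcal{V}\}$ (and likewise for differences). $F$ has Lipschitz Hessian with parameter $L$ if $\|D^2F(\boldsymbol{X})-D^2F(\boldsymbol{Y})\|\le L\|\boldsymbol{X}-\boldsymbol{Y}\|_F$ for all $\boldsymbol{X},\boldsymbol{Y}\in\mathcal{V}$. Cubic-regularized Newton algorithm. Input: $\boldsymbol{X}_0\in\mathcal{V}$ and $L_0\in(0,L]$. For $k=0,1,2,\dots$: (1) find $M_k\in[L_0,2L]$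 such that $F(\boldsymbol{T}_{M_k}(\boldsymbol{X}_k))\le F(\boldsymbol{X}_k)$, where $\boldsymbol{T}_{M_k}(\boldsymbol{X}_k)$ is an element of $$\operatorname*{Argmin}_{\boldsymbol{Y}\in\mathcal{V}}\Big[\langle\nabla F(\boldsymbol{X}_k),\boldsymbol{Y}-\boldsymbol{X}_k\rangle+\tfrac12\langle\nabla^2F(\boldsymbol{X}_k)[\boldsymbol{Y}-\boldsymbol{X}_k],\boldsymbol{Y}-\boldsymbol{X}_k\rangle+\tfrac{M_k}{6}\|\boldsymbol{Y}-\boldsymbol{X}_k\|_F^3\Big];$$ (2) set $\boldsymbol{X}_{k+1}=\boldsymbol{T}_{M_k}(\boldsymbol{X}_k)$. "Converges quadratically to $\boldsymbol{X}^*$" means $\boldsymbol{X}_k\to\boldsymbol{X}^*$ and there is a constant $c>0$ with $\|\boldsymbol{X}_{k+1}-\boldsymbol{X}^*\|_F\le c\|\boldsymbol{X}_k-\boldsymbol{X}^*\|_F^2$ for all sufficiently large $k$. *)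

theory Defs
  imports "HOL-Analysis.Analysis"
begin

text \<open>The space of square matrices is \<^typ>\<open>real^'n^'n\<close>; its library inner product and norm are the
  trace inner product and the Frobenius norm.\<close>

lemma inner_matrix_eq_trace:
  fixes A B :: "real^'n^'n"
  shows "A \<bullet> B = trace (transpose A ** B)"
proof -
  have "A \<bullet> B = (\<Sum>i\<in>UNIV. \<Sum>j\<in>UNIV. A $ i $ j * B $ i $ j)"
    by (simp add: inner_vec_def)
  also have "\<dots> = (\<Sum>j\<in>UNIV. \<Sum>i\<in>UNIV. A $ i $ j * B $ i $ j)"
    by (rule sum.swap)
  also have "\<dots> = trace (transpose A ** B)"
    by (simp add: trace_def matrix_matrix_mult_def transpose_def)
  finally show ?thesis .
qed

lemma norm_matrix_eq_Frobenius:
  fixes A :: "real^'n^'n"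
  shows "norm A = sqrt (\<Sum>i\<in>UNIV. \<Sum>j\<in>UNIV. (A $ i $ j)\<^sup>2)"
  by (simp add: norm_eq_sqrt_inner inner_vec_def power2_eq_square)

text \<open>A function on a subspace \<open>V\<close> is represented by a function on the whole space of which only the
  values on \<open>V\<close> matter. Derivatives are therefore taken within \<open>V\<close>; they are determined only on
  directions in \<open>V\<close>, so continuous differentiability asks for some continuous choice of them.\<close>

definition twice_cont_diff_on :: "'a::real_normed_vector set \<Rightarrow> ('a \<Rightarrow> real) \<Rightarrow> bool" where
  "twice_cont_diff_on V F \<longleftrightarrow>
     (\<exists>(F' :: 'a \<Rightarrow> 'a \<Rightarrow>\<^sub>L real) (F'' :: 'a \<Rightarrow> 'a \<Rightarrow>\<^sub>L 'a \<Rightarrow>\<^sub>L real).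
        (\<forall>X\<in>V. (F has_derivative blinfun_apply (F' X)) (at X within V)) \<and>
        (\<forall>X\<in>V. (F' has_derivative blinfun_apply (F'' X)) (at X within V)) \<and>
        continuous_on V F'')"

definition grad :: "'a::real_inner set \<Rightarrow> ('a \<Rightarrow> real) \<Rightarrow> 'a \<Rightarrow> 'a" where
  "grad V F X = (THE G. G \<in> V \<and>
     (\<forall>H\<in>V. ((\<lambda>t. F (X + t *\<^sub>R H)) has_real_derivative G \<bullet> H) (at 0)))"

definition hess :: "'a::real_inner set \<Rightarrow> ('a \<Rightarrow> real) \<Rightarrow> 'a \<Rightarrow> 'a \<Rightarrow> 'a" where
  "hess V F X H = vector_derivative (\<lambda>t. grad V F (X + t *\<^sub>R H)) (at 0)"

definition D2 :: "'a::real_inner set \<Rightarrow> ('a \<Rightarrow> real) \<Rightarrow> 'a \<Rightarrow> 'a \<Rightarrow> 'a \<Rightarrow> real" where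
  "D2 V F X H1 H2 = hess V F X H1 \<bullet> H2"

text \<open>Inserting \<open>0\<close> has no effect unless \<open>V\<close> is trivial and has no unit vectors; the norm is then \<open>0\<close>.\<close>

definition bilinear_norm :: "'a::real_normed_vector set \<Rightarrow> ('a \<Rightarrow> 'a \<Rightarrow> real) \<Rightarrow> real" where
  "bilinear_norm V B =
     Sup (insert 0 {\<bar>B H1 H2\<bar> | H1 H2. H1 \<in> V \<and> H2 \<in> V \<and> norm H1 = 1 \<and> norm H2 = 1})"

definition lipschitz_hessian :: "'a::real_inner set \<Rightarrow> ('a \<Rightarrow> real) \<Rightarrow> real \<Rightarrow> bool" where
  "lipschitz_hessian V F L \<longleftrightarrow>
     (\<forall>X\<in>V. \<forall>Y\<in>V.
        bilinear_norm V (\<lambda>H1 H2. D2 V F X H1 H2 - D2 V F Y H1 H2) \<le> L * norm (X - Y))"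

definition nondegenerate_local_min :: "'a::real_inner set \<Rightarrow> ('a \<Rightarrow> real) \<Rightarrow> 'a \<Rightarrow> bool" where
  "nondegenerate_local_min V F X \<longleftrightarrow>
     X \<in> V \<and> grad V F X = 0 \<and>
     (\<exists>\<delta>>0. \<forall>H\<in>V. hess V F X H \<bullet> H \<ge> \<delta> * (norm H)\<^sup>2)"

definition cubic_model :: "'a::real_inner set \<Rightarrow> ('a \<Rightarrow> real) \<Rightarrow> real \<Rightarrow> 'a \<Rightarrow> 'a \<Rightarrow> real" where
  "cubic_model V F M X Y =
     grad V F X \<bullet> (Y - X) + 1/2 * (hess V F X (Y - X) \<bullet> (Y - X)) + M/6 * norm (Y - X) ^ 3"

text \<open>\<open>X\<close> is a sequence of iterates that the algorithm may produce with regularization parameters \<open>M\<close>;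
  neither the parameters nor the minimizers of the cubic models need be unique.\<close>

definition cubic_newton_run ::
  "'a::real_inner set \<Rightarrow> ('a \<Rightarrow> real) \<Rightarrow> real \<Rightarrow> real \<Rightarrow> (nat \<Rightarrow> real) \<Rightarrow> (nat \<Rightarrow> 'a) \<Rightarrow> bool" where
  "cubic_newton_run V F L L0 M X \<longleftrightarrow>
     X 0 \<in> V \<and> 0 < L0 \<and> L0 \<le> L \<and>
     (\<forall>k. M k \<in> {L0..2 * L} \<and>
          is_arg_min (cubic_model V F (M k) (X k)) (\<lambda>Y. Y \<in> V) (X (Suc k)) \<and>
          F (X (Suc k)) \<le> F (X k))"

definition converges_quadratically :: "(nat \<Rightarrow> 'a::real_normed_vector) \<Rightarrow> 'a \<Rightarrow> bool" where
  "converges_quadratically X x \<longleftrightarrow>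
     X \<longlonglongrightarrow> x \<and>
     (\<exists>c>0. \<forall>\<^sub>F k in sequentially. norm (X (Suc k) - x) \<le> c * (norm (X k - x))\<^sup>2)"

end

theory Submission
  imports Defs
begin

text \<open>Near a non-degenerate minimizer the cubic step is a small perturbation of the Newton step. Write
  \<open>x\<close> for the minimizer, \<open>X\<close> for the current iterate, \<open>e = norm (X - x)\<close>, and \<open>X + s\<close> for the next
  iterate. When \<open>e\<close> is small, the Lipschitz condition keeps the Hessian \<open>H\<close> at \<open>X\<close> bounded below by
  \<open>\<delta>/2\<close>, while the gradient \<open>g\<close> at \<open>X\<close> is \<open>O(e)\<close>. Two facts about \<open>s\<close> then suffice.

  First, the model value at \<open>s\<close> is at most its value \<open>0\<close> at the zero step, and the cubic term is
  nonnegative, so \<open>\<delta>/4 * (norm s)^2 \<le> norm g * norm s\<close> and therefore \<open>s = O(e)\<close>. So even though the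
  step is a global minimizer of the model, it cannot jump to another basin.

  Second, the one-sided derivative of the model at \<open>s\<close> in the direction \<open>u = x - X - s\<close> is nonnegative
  (\<open>cubic_minimizer_variation\<close>), so \<open>H s \<bullet> u\<close> is at least \<open>- g \<bullet> u\<close> up to \<open>O(e^2) * norm u\<close>. Taylor
  expansion of the gradient at \<open>X\<close>, evaluated at its zero \<open>x\<close>, shows that \<open>H (x - X) \<bullet> u\<close> equals
  \<open>- g \<bullet> u\<close> up to an error of the same size. Subtracting, \<open>\<delta>/2 * (norm u)^2 \<le> H u \<bullet> u \<le> O(e^2) * norm u\<close>, so the new error
  \<open>norm u\<close> is \<open>O(e^2)\<close> (\<open>cubic_step_quadratic_error\<close>). If the initial error is small enough, each error
  is at most half the preceding one, and the bound applies at every step.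

  The second fact uses that the Hessian is symmetric, because differentiating the quadratic part of
  the model produces only the symmetric part of \<open>H\<close>. Symmetry comes from comparing \<open>H a \<bullet> b\<close> and
  \<open>H b \<bullet> a\<close> with one and the same second difference of \<open>F\<close>.

  The analysis is carried out for derivatives as bounded linear maps; \<open>grad_hess_as_derivatives\<close>
  shows that on \<open>V\<close> the gradient and the Hessian represent them.\<close>

section \<open>Riesz representation of derivatives on the subspace\<close>

text \<open>Expanding in an orthonormal basis of \<open>V\<close> makes the representing vector a bounded linear function of
  the functional, so representation commutes with differentiation. That is how the derivative of the
  gradient is computed from the second derivative.\<close>

lemma subspace_Riesz_operator:
  fixes V :: "'a::euclidean_space set"
  assumes "subspace V"
  obtains R :: "('a \<Rightarrow>\<^sub>L real) \<Rightarrow> 'a"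
  where "bounded_linear R" and "\<And>\<phi>. R \<phi> \<in> V"
    and "\<And>\<phi> v. v \<in> V \<Longrightarrow> R \<phi> \<bullet> v = blinfun_apply \<phi> v"
proof -
  obtain B where B: "B \<subseteq> V" "pairwise orthogonal B" "\<And>x. x \<in> B \<Longrightarrow> norm x = 1"
    "independent B" "span B = V"
    using orthonormal_basis_subspace[OF assms] by metis
  have fin: "finite B" using B(4) by (rule independent_imp_finite)
  define R where "R = (\<lambda>\<phi> :: 'a \<Rightarrow>\<^sub>L real. \<Sum>b\<in>B. blinfun_apply \<phi> b *\<^sub>R b)"
  have "bounded_linear R"
    unfolding R_def
    by (intro bounded_linear_sum bounded_linear_scaleR_const[OF bounded_linear_compose]
        blinfun.bounded_linear_left bounded_linear_compose[OF bounded_linear_scaleR_left])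
  moreover have "R \<phi> \<in> V" for \<phi>
    unfolding R_def using B(1) assms by (intro subspace_sum subspace_scale) auto
  moreover have "R \<phi> \<bullet> v = blinfun_apply \<phi> v" if "v \<in> V" for \<phi> v
  proof -
    have "v \<in> span B" using that B(5) by simp
    then show ?thesis
    proof (induction rule: span_induct)
      case base
      show ?case
        by (auto simp: subspace_def inner_right_distrib blinfun.add_right blinfun.scaleR_right)
    next
      case (step b)
      have "R \<phi> \<bullet> b = (\<Sum>b'\<in>B. blinfun_apply \<phi> b' * (b' \<bullet> b))"
        unfolding R_def by (simp add: inner_sum_left)
      also have "\<dots> = (\<Sum>b'\<in>B. if b' = b then blinfun_apply \<phi> b else 0)"
        using B(2,3) step
        by (intro sum.cong refl) (auto simp: pairwise_def orthogonal_def dot_square_norm)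
      also have "\<dots> = blinfun_apply \<phi> b" using fin step by simp
      finally show ?case .
    qed
  qed
  ultimately show thesis by (rule that)
qed

lemma has_vector_derivative_along_line:
  fixes f :: "'a::real_normed_vector \<Rightarrow> 'b::real_normed_vector"
  assumes "subspace V" "X \<in> V" "H \<in> V"
    and "(f has_derivative D) (at (X + r *\<^sub>R H) within V)"
  shows "((\<lambda>t. f (X + t *\<^sub>R H)) has_vector_derivative D H) (at r)"
proof -
  have lin: "linear D" using assms(4) by (rule has_derivative_linear)
  have sub: "(\<lambda>t. X + t *\<^sub>R H) ` UNIV \<subseteq> V"
    using assms(1-3) by (auto intro: subspace_add subspace_scale)
  have line: "((\<lambda>t. X + t *\<^sub>R H) has_derivative (\<lambda>t. t *\<^sub>R H)) (at r)"
    by (auto intro!: derivative_eq_intros)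
  have "((\<lambda>t. f (X + t *\<^sub>R H)) has_derivative (\<lambda>t. D (t *\<^sub>R H))) (at r)"
    by (rule has_derivative_in_compose[OF line has_derivative_subset[OF assms(4) sub]])
  then show ?thesis
    by (simp add: has_vector_derivative_def linear_scale[OF lin])
qed

text \<open>A gradient is determined by its directional derivatives: test the difference of two candidates,
  which lies in \<open>V\<close>, against itself.\<close>

lemma grad_eqI:
  assumes "subspace V" "G \<in> V"
    and "\<And>H. H \<in> V \<Longrightarrow> ((\<lambda>t. F (X + t *\<^sub>R H)) has_real_derivative G \<bullet> H) (at 0)"
  shows "grad V F X = G"
  unfolding grad_def
proof (rule the_equality)
  show "G \<in> V \<and> (\<forall>H\<in>V. ((\<lambda>t. F (X + t *\<^sub>R H)) has_real_derivative G \<bullet> H) (at 0))"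
    using assms by blast
next
  fix G' assume G': "G' \<in> V \<and> (\<forall>H\<in>V. ((\<lambda>t. F (X + t *\<^sub>R H)) has_real_derivative G' \<bullet> H) (at 0))"
  then have "G' - G \<in> V" using assms by (auto intro: subspace_diff)
  then have "G' \<bullet> (G' - G) = G \<bullet> (G' - G)" using G' assms(3) DERIV_unique by blast
  then have "(G' - G) \<bullet> (G' - G) = 0" by (simp add: inner_diff_left)
  then show "G' = G" by simp
qed

text \<open>Boundedness of the form is essential here: \<^const>\<open>bilinear_norm\<close> is a supremum of reals, which
  bounds its elements only if the set is bounded above.\<close>

lemma bilinear_norm_bound:
  assumes "subspace V" "bounded_bilinear B" "a \<in> V" "b \<in> V"
  shows "\<bar>B a b\<bar> \<le> bilinear_norm V B * norm a * norm b"
proof (cases "a = 0 \<or> b = 0")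
  case True
  then show ?thesis
    using bounded_bilinear.zero_left[OF assms(2)] bounded_bilinear.zero_right[OF assms(2)] by auto
next
  case False
  interpret bounded_bilinear B by fact
  let ?S = "{\<bar>B H1 H2\<bar> | H1 H2. H1 \<in> V \<and> H2 \<in> V \<and> norm H1 = 1 \<and> norm H2 = 1}"
  obtain K where K: "\<And>x y. norm (B x y) \<le> norm x * norm y * K" using bounded by blast
  have "bdd_above (insert 0 ?S)"
  proof (rule bdd_aboveI)
    fix z assume "z \<in> insert 0 ?S"
    then show "z \<le> max 0 K"
    proof
      assume "z \<in> ?S"
      then obtain x y where "z = \<bar>B x y\<bar>" "norm x = 1" "norm y = 1" by blast
      then show ?thesis using K[of x y] by simp
    qed simp
  qed
  moreover have "\<bar>B (a /\<^sub>R norm a) (b /\<^sub>R norm b)\<bar> \<in> insert 0 ?S"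
  proof -
    have "a /\<^sub>R norm a \<in> V" "b /\<^sub>R norm b \<in> V"
      using assms by (auto intro: subspace_scale)
    moreover have "norm (a /\<^sub>R norm a) = 1" "norm (b /\<^sub>R norm b) = 1" using False by auto
    ultimately show ?thesis by blast
  qed
  ultimately have "\<bar>B (a /\<^sub>R norm a) (b /\<^sub>R norm b)\<bar> \<le> bilinear_norm V B"
    unfolding bilinear_norm_def by (rule cSup_upper[rotated])
  moreover have "\<bar>B (a /\<^sub>R norm a) (b /\<^sub>R norm b)\<bar> = \<bar>B a b\<bar> / (norm a * norm b)"
    by (simp add: scaleR_left scaleR_right abs_mult divide_inverse mult_ac)
  ultimately have "\<bar>B a b\<bar> / (norm a * norm b) \<le> bilinear_norm V B" by simp
  then show ?thesis using False by (simp add: pos_divide_le_eq mult.assoc)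
qed

section \<open>Functions with Lipschitz second derivative on a subspace\<close>

text \<open>The maps \<open>F' X\<close> and \<open>F'' X\<close> are defined on the whole space, but they carry information about \<open>F\<close> only
  along \<open>V\<close>. The Lipschitz estimate is therefore asked for directions in \<open>V\<close> only.\<close>

locale lipschitz_second_derivative =
  fixes V :: "'a::real_inner set" and F :: "'a \<Rightarrow> real"
    and F' :: "'a \<Rightarrow> 'a \<Rightarrow>\<^sub>L real" and F'' :: "'a \<Rightarrow> 'a \<Rightarrow>\<^sub>L 'a \<Rightarrow>\<^sub>L real" and L :: real
  assumes subspace: "subspace V"
    and deriv1: "X \<in> V \<Longrightarrow> (F has_derivative blinfun_apply (F' X)) (at X within V)"
    and deriv2: "X \<in> V \<Longrightarrow> (F' has_derivative blinfun_apply (F'' X)) (at X within V)"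
    and L_nonneg: "0 \<le> L"
    and Lipschitz: "\<lbrakk>X \<in> V; Y \<in> V; a \<in> V; b \<in> V\<rbrakk> \<Longrightarrow>
      \<bar>F'' X a b - F'' Y a b\<bar> \<le> L * norm (X - Y) * norm a * norm b"
begin

lemma line_in_V: "\<lbrakk>X \<in> V; H \<in> V\<rbrakk> \<Longrightarrow> X + r *\<^sub>R H \<in> V"
  using subspace by (auto intro: subspace_add subspace_scale)

lemma deriv_F_line:
  assumes "X \<in> V" "H \<in> V"
  shows "((\<lambda>t. F (X + t *\<^sub>R H)) has_real_derivative F' (X + r *\<^sub>R H) H) (at r)"
  using has_vector_derivative_along_line[OF subspace assms deriv1[OF line_in_V[OF assms]]]
  by (simp add: has_real_derivative_iff_has_vector_derivative)

lemma vector_deriv_F'_line: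
  assumes "X \<in> V" "H \<in> V"
  shows "((\<lambda>t. F' (X + t *\<^sub>R H)) has_vector_derivative F'' (X + r *\<^sub>R H) H) (at r)"
  by (rule has_vector_derivative_along_line[OF subspace assms deriv2[OF line_in_V[OF assms]]])

lemma deriv_F'_line:
  assumes "X \<in> V" "H \<in> V"
  shows "((\<lambda>t. F' (X + t *\<^sub>R H) u) has_real_derivative F'' (X + r *\<^sub>R H) H u) (at r)"
  using bounded_linear.has_vector_derivative[OF blinfun.bounded_linear_left
      vector_deriv_F'_line[OF assms]]
  by (simp add: has_real_derivative_iff_has_vector_derivative)

lemma derivative_mean_value:
  assumes "X \<in> V" "H \<in> V"
  obtains r where "0 < r" "r < 1" "F' (X + H) u - F' X u = F'' (X + r *\<^sub>R H) H u"
proof -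
  obtain r where "0 < r" "r < 1"
    "F' (X + 1 *\<^sub>R H) u - F' (X + 0 *\<^sub>R H) u = (1 - 0) * F'' (X + r *\<^sub>R H) H u"
    using MVT2[of 0 1 "\<lambda>t. F' (X + t *\<^sub>R H) u" "\<lambda>r. F'' (X + r *\<^sub>R H) H u"]
      deriv_F'_line[OF assms, of u] by auto
  then show thesis using that by simp
qed

text \<open>The mean value theorem yields the constant \<open>L\<close> in place of the optimal \<open>L/2\<close> from integration; only
  the order in \<open>norm H\<close> matters for the rate.\<close>

lemma derivative_Taylor:
  assumes "X \<in> V" "H \<in> V" "u \<in> V"
  shows "\<bar>F' (X + H) u - F' X u - F'' X H u\<bar> \<le> L * (norm H)\<^sup>2 * norm u"
proof -
  obtain r where r: "0 < r" "r < 1" "F' (X + H) u - F' X u = F'' (X + r *\<^sub>R H) H u"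
    using derivative_mean_value[OF assms(1,2)] by blast
  have "\<bar>F'' (X + r *\<^sub>R H) H u - F'' X H u\<bar> \<le> L * norm (r *\<^sub>R H) * norm H * norm u"
    using Lipschitz[OF line_in_V[OF assms(1,2)] assms(1) assms(2,3), of r] by simp
  also have "\<dots> \<le> L * norm H * norm H * norm u"
    using r L_nonneg by (intro mult_right_mono mult_left_mono) (auto simp: mult_left_le_one_le)
  finally show ?thesis using r by (simp add: power2_eq_square mult_ac)
qed

text \<open>Two applications of the mean value theorem, in the direction \<open>b\<close> and then in the direction \<open>a\<close>,
  make the second difference equal to \<open>F'' Z a b\<close> at a point \<open>Z\<close> of the parallelogram spanned at \<open>X\<close>.\<close>

lemma second_difference:
  assumes "X \<in> V" "a \<in> V" "b \<in> V"
  shows "\<bar>(F (X + a + b) - F (X + a) - F (X + b) + F X) - F'' X a b\<bar>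
    \<le> L * (norm a + norm b) * norm a * norm b"
proof -
  have Xa: "X + a \<in> V" using assms subspace by (auto intro: subspace_add)
  have "\<exists>r. 0 < r \<and> r < 1 \<and>
     (F (X + a + 1 *\<^sub>R b) - F (X + 1 *\<^sub>R b)) - (F (X + a + 0 *\<^sub>R b) - F (X + 0 *\<^sub>R b))
     = (1 - 0) * (F' (X + a + r *\<^sub>R b) b - F' (X + r *\<^sub>R b) b)"
    by (rule MVT2[of 0 1 "\<lambda>t. F (X + a + t *\<^sub>R b) - F (X + t *\<^sub>R b)"])
      (auto intro!: DERIV_diff deriv_F_line assms Xa)
  then obtain r where r: "0 < r" "r < 1"
    "F (X + a + b) - F (X + a) - F (X + b) + F X = F' (X + a + r *\<^sub>R b) b - F' (X + r *\<^sub>R b) b"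
    by (auto simp: algebra_simps)
  have Xb: "X + r *\<^sub>R b \<in> V" by (rule line_in_V[OF assms(1,3)])
  obtain q where q: "0 < q" "q < 1"
    "F' (X + r *\<^sub>R b + a) b - F' (X + r *\<^sub>R b) b = F'' (X + r *\<^sub>R b + q *\<^sub>R a) a b"
    using derivative_mean_value[OF Xb assms(2)] by blast
  have eq: "F (X + a + b) - F (X + a) - F (X + b) + F X = F'' (X + r *\<^sub>R b + q *\<^sub>R a) a b"
    using r q by (simp add: add_ac)
  have "\<bar>F'' (X + r *\<^sub>R b + q *\<^sub>R a) a b - F'' X a b\<bar>
      \<le> L * norm (r *\<^sub>R b + q *\<^sub>R a) * norm a * norm b"
    using Lipschitz[OF line_in_V[OF Xb assms(2)] assms(1) assms(2,3), of q]
    by (simp add: add.assoc)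
  also have "\<dots> \<le> L * (norm a + norm b) * norm a * norm b"
  proof (intro mult_right_mono mult_left_mono L_nonneg norm_ge_zero)
    have "norm (r *\<^sub>R b + q *\<^sub>R a) \<le> r * norm b + q * norm a"
      using norm_triangle_ineq[of "r *\<^sub>R b" "q *\<^sub>R a"] r q by simp
    also have "\<dots> \<le> norm b + norm a"
      using r q by (intro add_mono) (auto simp: mult_left_le_one_le)
    finally show "norm (r *\<^sub>R b + q *\<^sub>R a) \<le> norm a + norm b" by simp
  qed
  finally show ?thesis using eq by simp
qed

text \<open>The second difference is symmetric in \<open>a\<close> and \<open>b\<close>, so it approximates both sides.\<close>

lemma second_derivative_almost_symmetric:
  assumes "X \<in> V" "a \<in> V" "b \<in> V"
  shows "\<bar>F'' X a b - F'' X b a\<bar> \<le> 2 * L * (norm a + norm b) * norm a * norm b"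
proof -
  define D where "D = F (X + a + b) - F (X + a) - F (X + b) + F X"
  define E where "E = L * (norm a + norm b) * norm a * norm b"
  have "\<bar>D - F'' X a b\<bar> \<le> E"
    unfolding D_def E_def by (rule second_difference[OF assms])
  moreover have "F (X + b + a) - F (X + b) - F (X + a) + F X = D"
    by (simp add: D_def add_ac)
  then have "\<bar>D - F'' X b a\<bar> \<le> E"
    using second_difference[OF assms(1,3,2)] by (simp add: E_def mult_ac add_ac)
  ultimately have "\<bar>F'' X a b - F'' X b a\<bar> \<le> 2 * E" by linarith
  then show ?thesis by (simp add: E_def mult.assoc)
qed

text \<open>Scaling both directions by \<open>t\<close> scales the asymmetry by \<open>t^2\<close> but its bound by \<open>t^3\<close>; let \<open>t\<close> tend
  to \<open>0\<close>.\<close>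

lemma second_derivative_symmetric:
  assumes "X \<in> V" "a \<in> V" "b \<in> V"
  shows "F'' X a b = F'' X b a"
proof -
  define C where "C = 2 * L * (norm a + norm b) * norm a * norm b"
  have bound: "\<bar>F'' X a b - F'' X b a\<bar> \<le> C * t" if "0 < t" for t
  proof -
    have V: "t *\<^sub>R a \<in> V" "t *\<^sub>R b \<in> V" using assms subspace by (auto intro: subspace_scale)
    have "\<bar>F'' X (t *\<^sub>R a) (t *\<^sub>R b) - F'' X (t *\<^sub>R b) (t *\<^sub>R a)\<bar>
        \<le> 2 * L * (norm (t *\<^sub>R a) + norm (t *\<^sub>R b)) * norm (t *\<^sub>R a) * norm (t *\<^sub>R b)"
      by (rule second_derivative_almost_symmetric[OF assms(1) V])
    also have "\<dots> = t\<^sup>2 * (C * t)"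
      using that by (simp add: C_def power2_eq_square algebra_simps)
    also have "F'' X (t *\<^sub>R a) (t *\<^sub>R b) - F'' X (t *\<^sub>R b) (t *\<^sub>R a)
        = t\<^sup>2 * (F'' X a b - F'' X b a)"
      by (simp add: blinfun.scaleR_left blinfun.scaleR_right power2_eq_square algebra_simps)
    finally show ?thesis using that by (simp add: abs_mult)
  qed
  have "((\<lambda>t. C * t) \<longlongrightarrow> C * 0) (at_right 0)" by (intro tendsto_intros)
  then have "\<bar>F'' X a b - F'' X b a\<bar> \<le> C * 0"
    by (rule tendsto_lowerbound) (auto simp: eventually_at_right_less bound
        intro: eventually_mono[OF eventually_at_right_less])
  then show ?thesis by simp
qed

text \<open>The first-order condition for a minimizer of the model, as an inequality. Replacing
  \<open>norm (s + t *\<^sub>R u)\<close> by the larger \<open>norm s + t * norm u\<close> turns the growth of the model along the ray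
  into a polynomial in \<open>t\<close>, so the norm never has to be differentiated and \<open>s = 0\<close> is no special case.
  The loss is harmless, since the cubic term enters the error estimate only through
  \<open>(norm s)^2 * norm u\<close>.\<close>

lemma cubic_minimizer_variation:
  assumes "X \<in> V" "s \<in> V" "u \<in> V" "0 \<le> M"
    and min: "\<And>h. h \<in> V \<Longrightarrow> F' X s + 1/2 * F'' X s s + M/6 * norm s ^ 3
      \<le> F' X h + 1/2 * F'' X h h + M/6 * norm h ^ 3"
  shows "0 \<le> F' X u + F'' X s u + M/2 * (norm s)\<^sup>2 * norm u"
proof -
  \<comment> \<open>An upper bound for the growth of the model from \<open>s\<close> to \<open>s + t *\<^sub>R u\<close>, divided by \<open>t\<close>.\<close>
  define p where "p t = (F' X u + F'' X s u + M/2 * (norm s)\<^sup>2 * norm u)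
     + t * (1/2 * F'' X u u + M/2 * norm s * (norm u)\<^sup>2) + t\<^sup>2 * (M/6 * norm u ^ 3)" for t :: real
  have pos: "0 \<le> p t" if t: "0 < t" for t
  proof -
    have "norm (s + t *\<^sub>R u) \<le> norm s + t * norm u"
      using norm_triangle_ineq[of s "t *\<^sub>R u"] t by simp
    then have "M/6 * norm (s + t *\<^sub>R u) ^ 3 \<le> M/6 * (norm s + t * norm u) ^ 3"
      using assms(4) by (intro mult_left_mono power_mono) auto
    moreover have "F' X (s + t *\<^sub>R u) = F' X s + t * F' X u"
      by (simp add: blinfun.add_right blinfun.scaleR_right)
    moreover have "F'' X (s + t *\<^sub>R u) (s + t *\<^sub>R u)
        = F'' X s s + 2 * t * F'' X s u + t\<^sup>2 * F'' X u u"
      using second_derivative_symmetric[OF assms(1-3)]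
      by (simp add: blinfun.add_right blinfun.add_left blinfun.scaleR_left blinfun.scaleR_right
          algebra_simps power2_eq_square)
    moreover note min[OF line_in_V[OF assms(2,3), of t]]
    ultimately have "0 \<le> t * F' X u + 1/2 * (2 * t * F'' X s u + t\<^sup>2 * F'' X u u)
        + (M/6 * (norm s + t * norm u) ^ 3 - M/6 * norm s ^ 3)" by (simp add: algebra_simps)
    also have "\<dots> = t * p t" unfolding p_def by (simp add: algebra_simps power2_eq_square power3_eq_cube)
    finally show ?thesis using t by (simp add: zero_le_mult_iff)
  qed
  have "((\<lambda>t. p t) \<longlongrightarrow> p 0) (at_right 0)" unfolding p_def by (intro tendsto_intros)
  then have "0 \<le> p 0"
    by (rule tendsto_lowerbound) (auto simp: pos intro: eventually_mono[OF eventually_at_right_less])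
  then show ?thesis by (simp add: p_def)
qed

text \<open>The two bounds on \<open>norm (X - Xs)\<close> have separate uses: the one involving \<open>\<delta>\<close> keeps \<open>F''\<close> coercive
  at \<open>X\<close>, and \<open>norm (X - Xs) \<le> 1\<close> absorbs the quadratic Taylor remainder of \<open>F'\<close> into a bound linear
  in the error. The squared quotient in the constant is the square of the factor that bounds the step
  length by the error.\<close>

lemma cubic_step_quadratic_error:
  assumes Xs: "Xs \<in> V" "\<And>u. u \<in> V \<Longrightarrow> F' Xs u = 0"
    and \<delta>: "0 < \<delta>" "\<And>u. u \<in> V \<Longrightarrow> \<delta> * (norm u)\<^sup>2 \<le> F'' Xs u u"
    and X: "X \<in> V" "norm (X - Xs) \<le> 1" "L * norm (X - Xs) \<le> \<delta> / 2"
    and M: "0 \<le> M" "M \<le> 2 * L"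
    and s: "s \<in> V" "\<And>h. h \<in> V \<Longrightarrow> F' X s + 1/2 * F'' X s s + M/6 * norm s ^ 3
      \<le> F' X h + 1/2 * F'' X h h + M/6 * norm h ^ 3"
  shows "norm (X + s - Xs) \<le>
    2 * L / \<delta> * (1 + (4 * (norm (F'' Xs) + L) / \<delta>)\<^sup>2) * (norm (X - Xs))\<^sup>2"
proof -
  define e where "e = norm (X - Xs)"
  define K where "K = 4 * (norm (F'' Xs) + L) / \<delta>"
  \<comment> \<open>The negative of the new error, which is also the test direction for the first-order condition.\<close>
  define u where "u = Xs - X - s"
  have dV: "X - Xs \<in> V" "Xs - X \<in> V" using X Xs subspace by (auto intro: subspace_diff)
  have uV: "u \<in> V" using dV s subspace by (auto simp: u_def intro: subspace_diff)
  have e0: "0 \<le> e" by (simp add: e_def)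
  have coercive: "\<delta> / 2 * (norm v)\<^sup>2 \<le> F'' X v v" if "v \<in> V" for v
  proof -
    have "\<bar>F'' X v v - F'' Xs v v\<bar> \<le> L * e * norm v * norm v"
      using Lipschitz[OF X(1) Xs(1) that that] by (simp add: e_def)
    also have "\<dots> \<le> \<delta> / 2 * norm v * norm v"
      using X(3) by (intro mult_right_mono) (auto simp: e_def)
    finally have "\<bar>F'' X v v - F'' Xs v v\<bar> \<le> \<delta> / 2 * (norm v)\<^sup>2"
      by (simp add: power2_eq_square)
    then show ?thesis using \<delta>(2)[OF that] by linarith
  qed
  have grad_bound: "\<bar>F' X v\<bar> \<le> (norm (F'' Xs) + L) * e * norm v" if "v \<in> V" for v
  proof -
    have "\<bar>F' X v - F'' Xs (X - Xs) v\<bar> \<le> L * e\<^sup>2 * norm v"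
      using derivative_Taylor[OF Xs(1) dV(1) that] Xs(2)[OF that] by (simp add: e_def)
    also have "\<dots> \<le> L * e * norm v"
    proof (intro mult_right_mono mult_left_mono L_nonneg norm_ge_zero)
      show "e\<^sup>2 \<le> e"
        using X(2) e0 by (auto simp: e_def power2_eq_square intro: mult_left_le_one_le)
    qed
    finally have 1: "\<bar>F' X v - F'' Xs (X - Xs) v\<bar> \<le> L * e * norm v" .
    have "\<bar>F'' Xs (X - Xs) v\<bar> \<le> norm (F'' Xs (X - Xs)) * norm v"
      using norm_blinfun[of "F'' Xs (X - Xs)" v] by simp
    also have "\<dots> \<le> norm (F'' Xs) * e * norm v"
      unfolding e_def by (intro mult_right_mono norm_blinfun) auto
    finally show ?thesis using 1 by (simp add: algebra_simps)
  qed
  have step: "norm s \<le> K * e"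
  proof (cases "s = 0")
    case True
    then show ?thesis using \<delta> L_nonneg e0 by (auto simp: K_def)
  next
    case False
    have "F' X s + 1/2 * F'' X s s + M/6 * norm s ^ 3 \<le> 0"
      using s(2)[of 0] subspace by (simp add: subspace_0)
    moreover have "0 \<le> M/6 * norm s ^ 3" using M by simp
    moreover note grad_bound[OF s(1)] coercive[OF s(1)]
    ultimately have "\<delta> / 4 * (norm s)\<^sup>2 \<le> (norm (F'' Xs) + L) * e * norm s" by linarith
    then have "\<delta> / 4 * norm s \<le> (norm (F'' Xs) + L) * e"
      using False by (simp add: power2_eq_square)
    then show ?thesis using \<delta>(1) by (simp add: K_def field_simps)
  qed
  have split: "F'' X u v = F'' X (Xs - X) v - F'' X s v" for v
    unfolding u_def by (simp add: blinfun.diff_left blinfun.diff_right)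
  have "\<delta> / 2 * (norm u)\<^sup>2 \<le> F'' X u u" by (rule coercive[OF uV])
  also have "\<dots> = F'' X (Xs - X) u - F'' X s u"
    by (rule split)
  also have "\<dots> \<le> (L * e\<^sup>2 + M/2 * (norm s)\<^sup>2) * norm u"
    using derivative_Taylor[OF X(1) dV(2) uV] Xs(2)[OF uV]
      cubic_minimizer_variation[OF X(1) s(1) uV M(1) s(2)]
    by (simp add: e_def norm_minus_commute algebra_simps)
  also have "\<dots> \<le> (L * e\<^sup>2 + L * (K * e)\<^sup>2) * norm u"
  proof (intro mult_right_mono add_left_mono norm_ge_zero)
    have "(norm s)\<^sup>2 \<le> (K * e)\<^sup>2" using step by (rule power_mono) simp
    then show "M/2 * (norm s)\<^sup>2 \<le> L * (K * e)\<^sup>2"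
      using M L_nonneg by (intro mult_mono) auto
  qed
  finally have *: "\<delta> / 2 * (norm u)\<^sup>2 \<le> (L * e\<^sup>2 + L * (K * e)\<^sup>2) * norm u" .
  have "norm u \<le> 2 * L / \<delta> * (1 + K\<^sup>2) * e\<^sup>2"
  proof (cases "u = 0")
    case True
    then show ?thesis using \<delta> L_nonneg by simp
  next
    case False
    with * have "\<delta> / 2 * norm u \<le> L * e\<^sup>2 + L * (K * e)\<^sup>2"
      by (simp add: power2_eq_square)
    then show ?thesis using \<delta>(1) by (simp add: field_simps)
  qed
  moreover have "norm (X + s - Xs) = norm u"
    using norm_minus_cancel[of u] by (simp add: u_def algebra_simps)
  ultimately show ?thesis by (simp add: e_def K_def)
qed

end

section \<open>Gradient and Hessian as derivatives\<close>

lemma grad_hess_as_derivatives: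
  fixes V :: "'a::euclidean_space set"
  assumes "subspace V" "twice_cont_diff_on V F" "0 \<le> L" "lipschitz_hessian V F L"
  obtains F' F'' where "lipschitz_second_derivative V F F' F'' L"
    and "\<And>X v. \<lbrakk>X \<in> V; v \<in> V\<rbrakk> \<Longrightarrow> grad V F X \<bullet> v = blinfun_apply (F' X) v"
    and "\<And>X a b. \<lbrakk>X \<in> V; a \<in> V; b \<in> V\<rbrakk> \<Longrightarrow>
      hess V F X a \<bullet> b = blinfun_apply (blinfun_apply (F'' X) a) b"
proof -
  obtain F' :: "'a \<Rightarrow> 'a \<Rightarrow>\<^sub>L real" and F'' :: "'a \<Rightarrow> 'a \<Rightarrow>\<^sub>L 'a \<Rightarrow>\<^sub>L real" where
    D1: "\<And>X. X \<in> V \<Longrightarrow> (F has_derivative blinfun_apply (F' X)) (at X within V)" and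
    D2: "\<And>X. X \<in> V \<Longrightarrow> (F' has_derivative blinfun_apply (F'' X)) (at X within V)"
    using assms(2) unfolding twice_cont_diff_on_def by blast
  obtain R :: "('a \<Rightarrow>\<^sub>L real) \<Rightarrow> 'a" where R: "bounded_linear R" "\<And>\<phi>. R \<phi> \<in> V"
    "\<And>\<phi> v. v \<in> V \<Longrightarrow> R \<phi> \<bullet> v = blinfun_apply \<phi> v"
    using subspace_Riesz_operator[OF assms(1)] by blast
  have grad: "grad V F X = R (F' X)" if X: "X \<in> V" for X
  proof (rule grad_eqI[OF assms(1) R(2)])
    fix H assume H: "H \<in> V"
    have "(F has_derivative blinfun_apply (F' X)) (at (X + 0 *\<^sub>R H) within V)"
      using D1[OF X] by simp
    from has_vector_derivative_along_line[OF assms(1) X H this]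
    show "((\<lambda>t. F (X + t *\<^sub>R H)) has_real_derivative R (F' X) \<bullet> H) (at 0)"
      by (simp add: R(3)[OF H] has_real_derivative_iff_has_vector_derivative)
  qed
  have hess: "hess V F X H = R (F'' X H)" if X: "X \<in> V" and H: "H \<in> V" for X H
  proof -
    have "(F' has_derivative blinfun_apply (F'' X)) (at (X + 0 *\<^sub>R H) within V)"
      using D2[OF X] by simp
    from bounded_linear.has_vector_derivative[OF R(1)
        has_vector_derivative_along_line[OF assms(1) X H this]]
    have "((\<lambda>t. R (F' (X + t *\<^sub>R H))) has_vector_derivative R (F'' X H)) (at 0)" .
    moreover have "grad V F (X + t *\<^sub>R H) = R (F' (X + t *\<^sub>R H))" for t
      using X H assms(1) by (intro grad subspace_add subspace_scale)
    ultimately show ?thesis unfolding hess_def by (simp add: vector_derivative_at)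
  qed
  have hess_inner: "hess V F X a \<bullet> b = F'' X a b" if "X \<in> V" "a \<in> V" "b \<in> V" for X a b
    using that by (simp add: hess R(3))
  have Lip: "\<bar>F'' X a b - F'' Y a b\<bar> \<le> L * norm (X - Y) * norm a * norm b"
    if V: "X \<in> V" "Y \<in> V" "a \<in> V" "b \<in> V" for X Y a b
  proof -
    let ?B = "\<lambda>a b. (F'' X - F'' Y) a b"
    have bil: "bounded_bilinear ?B"
      by (rule bounded_bilinear.comp1[OF bounded_bilinear_blinfun_apply blinfun.bounded_linear_right])
    have "bilinear_norm V ?B = bilinear_norm V (\<lambda>H1 H2. D2 V F X H1 H2 - D2 V F Y H1 H2)"
      unfolding bilinear_norm_def
      by (rule arg_cong[where f = "\<lambda>S. Sup (insert 0 S)"])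
        (use V in \<open>auto simp: D2_def hess_inner blinfun.diff_left intro!: Collect_cong ex_cong1\<close>)
    also have "\<dots> \<le> L * norm (X - Y)"
      using assms(4) V unfolding lipschitz_hessian_def by blast
    finally have "bilinear_norm V ?B * norm a * norm b \<le> L * norm (X - Y) * norm a * norm b"
      by (intro mult_right_mono) auto
    with bilinear_norm_bound[OF assms(1) bil V(3,4)] show ?thesis
      by (simp add: blinfun.diff_left)
  qed
  show thesis
  proof (rule that)
    show "lipschitz_second_derivative V F F' F'' L"
      using assms(1,3) D1 D2 Lip by unfold_locales
    show "grad V F X \<bullet> v = F' X v" if "X \<in> V" "v \<in> V" for X v
      using that by (simp add: grad R(3))
  qed (rule hess_inner)
qed

section \<open>Local quadratic convergence\<close>

text \<open>The condition \<open>c * \<epsilon> \<le> 1/2\<close> turns the quadratic bound into halving of the error, which keeps the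
  sequence inside the ball where the bound is valid and forces convergence.\<close>

lemma converges_quadratically_if_local_error_bound:
  assumes c: "0 < c" "c * \<epsilon> \<le> 1 / 2" and start: "norm (X 0 - x) < \<epsilon>"
    and step: "\<And>k. norm (X k - x) < \<epsilon> \<Longrightarrow> norm (X (Suc k) - x) \<le> c * (norm (X k - x))\<^sup>2"
  shows "converges_quadratically X x"
proof -
  have \<epsilon>: "0 < \<epsilon>" using start by (rule le_less_trans[OF norm_ge_zero])
  have half: "norm (X (Suc k) - x) \<le> norm (X k - x) / 2" if "norm (X k - x) < \<epsilon>" for k
  proof -
    have "c * norm (X k - x) \<le> c * \<epsilon>" using that c by (intro mult_left_mono) auto
    then have "c * norm (X k - x) \<le> 1 / 2" using c(2) by linarith
    then have "c * norm (X k - x) * norm (X k - x) \<le> 1 / 2 * norm (X k - x)"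
      by (rule mult_right_mono) simp
    with step[OF that] show ?thesis by (simp add: power2_eq_square mult.assoc)
  qed
  have geom: "norm (X k - x) < \<epsilon> \<and> norm (X k - x) \<le> \<epsilon> * (1 / 2) ^ k" for k
  proof (induction k)
    case 0
    then show ?case using start by simp
  next
    case (Suc k)
    then have step_half: "norm (X (Suc k) - x) \<le> norm (X k - x) / 2" using half by blast
    also have "\<dots> \<le> norm (X k - x)" by simp
    finally have "norm (X (Suc k) - x) < \<epsilon>" using Suc by simp
    then show ?case using step_half Suc by simp
  qed
  have "(\<lambda>k. \<epsilon> * (1 / 2) ^ k) \<longlonglongrightarrow> \<epsilon> * 0"
    by (intro tendsto_intros LIMSEQ_realpow_zero) auto
  then have "(\<lambda>k. \<epsilon> * (1 / 2) ^ k) \<longlonglongrightarrow> 0" by simp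
  then have "(\<lambda>k. X k - x) \<longlonglongrightarrow> 0"
    by (rule Lim_null_comparison[rotated]) (simp add: geom)
  then have "X \<longlonglongrightarrow> x" by (simp add: LIM_zero_iff)
  then show ?thesis
    unfolding converges_quadratically_def using c step geom by auto
qed

theorem theorem6:
  fixes V :: "(real^'n^'n) set" and d :: nat
    and F :: "real^'n^'n \<Rightarrow> real" and L Fstar :: real
    and Xstar :: "real^'n^'n"
  assumes "subspace V" and "dim V = d"
    and "twice_cont_diff_on V F"
    and "L > 0" and "lipschitz_hessian V F L"
    and "\<forall>X\<in>V. Fstar \<le> F X"
    and "nondegenerate_local_min V F Xstar"
  shows "\<exists>\<epsilon>>0. \<forall>L0 M X.
           cubic_newton_run V F L L0 M X \<and> norm (X 0 - Xstar) < \<epsilon> \<longrightarrow>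
           converges_quadratically X Xstar"
proof -
  obtain F' F'' where lsd: "lipschitz_second_derivative V F F' F'' L"
    and grad: "\<And>X v. \<lbrakk>X \<in> V; v \<in> V\<rbrakk> \<Longrightarrow> grad V F X \<bullet> v = blinfun_apply (F' X) v"
    and hess: "\<And>X a b. \<lbrakk>X \<in> V; a \<in> V; b \<in> V\<rbrakk> \<Longrightarrow>
      hess V F X a \<bullet> b = blinfun_apply (blinfun_apply (F'' X) a) b"
    using grad_hess_as_derivatives[OF assms(1,3) less_imp_le[OF assms(4)] assms(5)] by blast
  interpret lipschitz_second_derivative V F F' F'' L by (rule lsd)
  from assms(7) obtain \<delta> where Xstar: "Xstar \<in> V" "grad V F Xstar = 0"
    and \<delta>: "0 < \<delta>" "\<And>H. H \<in> V \<Longrightarrow> \<delta> * (norm H)\<^sup>2 \<le> hess V F Xstar H \<bullet> H"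
    unfolding nondegenerate_local_min_def by blast
  define c where "c = 2 * L / \<delta> * (1 + (4 * (norm (F'' Xstar) + L) / \<delta>)\<^sup>2)"
  have c: "0 < c"
    unfolding c_def using assms(4) \<delta>(1) by (intro mult_pos_pos add_pos_nonneg) auto
  \<comment> \<open>The first two bounds are the hypotheses of the one-step estimate; the third makes errors halve.\<close>
  define \<epsilon> where "\<epsilon> = min 1 (min (\<delta> / (2 * L)) (1 / (2 * c)))"
  have \<epsilon>: "0 < \<epsilon>" "\<epsilon> \<le> 1" "\<epsilon> \<le> \<delta> / (2 * L)" "\<epsilon> \<le> 1 / (2 * c)"
    using assms(4) \<delta>(1) c by (auto simp: \<epsilon>_def)
  have "converges_quadratically X Xstar"
    if run: "cubic_newton_run V F L L0 M X" and start: "norm (X 0 - Xstar) < \<epsilon>" for L0 M X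
  proof (rule converges_quadratically_if_local_error_bound[where X = X, OF c _ start])
    show "c * \<epsilon> \<le> 1 / 2" using \<epsilon>(4) c by (simp add: field_simps)
  next
    fix k assume near: "norm (X k - Xstar) < \<epsilon>"
    have XV: "X j \<in> V" for j
      using run by (cases j) (auto simp: cubic_newton_run_def is_arg_min_def)
    have L0: "0 < L0" and Mk: "M k \<in> {L0..2 * L}"
      and argmin: "is_arg_min (cubic_model V F (M k) (X k)) (\<lambda>Y. Y \<in> V) (X (Suc k))"
      using run unfolding cubic_newton_run_def by blast+
    from L0 Mk have M: "0 \<le> M k" "M k \<le> 2 * L" by auto
    define s where "s = X (Suc k) - X k"
    have sV: "s \<in> V" using XV assms(1) by (auto simp: s_def intro: subspace_diff)
    have model: "cubic_model V F (M k) (X k) (X k + h)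
        = F' (X k) h + 1/2 * F'' (X k) h h + M k / 6 * norm h ^ 3" if "h \<in> V" for h
      using that XV by (simp add: cubic_model_def grad hess)
    have min: "F' (X k) s + 1/2 * F'' (X k) s s + M k / 6 * norm s ^ 3
        \<le> F' (X k) h + 1/2 * F'' (X k) h h + M k / 6 * norm h ^ 3" if "h \<in> V" for h
    proof -
      have "X k + h \<in> V" using that XV assms(1) by (auto intro: subspace_add)
      then have "cubic_model V F (M k) (X k) (X k + s) \<le> cubic_model V F (M k) (X k) (X k + h)"
        using argmin by (auto simp: is_arg_min_linorder s_def)
      then show ?thesis using model that sV by simp
    qed
    have "L * norm (X k - Xstar) \<le> L * (\<delta> / (2 * L))"
      using near \<epsilon>(3) assms(4) by (intro mult_left_mono) auto
    then have "L * norm (X k - Xstar) \<le> \<delta> / 2" using assms(4) by simp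
    moreover have "F' Xstar u = 0" if "u \<in> V" for u
      using grad[OF Xstar(1) that] Xstar(2) by simp
    moreover have "\<delta> * (norm u)\<^sup>2 \<le> F'' Xstar u u" if "u \<in> V" for u
      using \<delta>(2)[OF that] hess[OF Xstar(1) that that] by simp
    ultimately have "norm (X k + s - Xstar) \<le> c * (norm (X k - Xstar))\<^sup>2"
      unfolding c_def using near \<epsilon>(2)
      by (intro cubic_step_quadratic_error[OF Xstar(1) _ \<delta>(1) _ XV _ _ M sV min]) auto
    then show "norm (X (Suc k) - Xstar) \<le> c * (norm (X k - Xstar))\<^sup>2" by (simp add: s_def)
  qed
  then show ?thesis using \<epsilon>(1) by blast
qed

end
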